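(* Let $G$ be an integer-weighted graph on $n$ vertices. If $L(G)$ is diagonalisable by a Butson Hadamard matrix $H\in H(2^m,n)$ for some positive integer $m$, then all integer eigenvalues of $L(G)$ are even.
   Context: Graphs are simple (no loops, no multiple edges) and weighted with non-negative edge weights; integer-weighted means all edge weights are integers. The adjacency matrix $A(G)$ has $(i,j)$ entry equal to the weight of the edge $ij$ (zero if there is no edge), and $L(G)=D(G)-A(G)$, where $D(G)$ is the diagonal matrix of row sums of $A(G)$. $H(r,n)$ denotes the set of Butson Hadamard matrices: $n\times n$ matrices $H$ whose entries are all $r$-th roots of unity and which satisfy $HH^*=nI$. A matrix is diagonalisable by $H$ if every column of $H$ is an eigenvector of it (equivalently $H^{-1}L(G)H$ is diagonal). *)

theory Defs
  imports Complex_Main "Jordan_Normal_Form.Schur_Decomposition"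
begin

text \<open>A weighted simple graph has vertices \<open>0, \<dots>, n - 1\<close>; an edge is a two-element set of
  vertices. The value of the weight function outside the edge set is irrelevant.\<close>

locale weighted_graph =
  fixes n :: nat and E :: "nat set set" and w :: "nat set \<Rightarrow> real"
  assumes edges: "\<And>e. e \<in> E \<Longrightarrow> e \<subseteq> {..<n} \<and> card e = 2"
    and weight_nonneg: "\<And>e. e \<in> E \<Longrightarrow> w e \<ge> 0"

definition integer_weighted :: "nat set set \<Rightarrow> (nat set \<Rightarrow> real) \<Rightarrow> bool" where
  "integer_weighted E w \<longleftrightarrow> (\<forall>e\<in>E. w e \<in> \<int>)"

text \<open>The matrices are complex, since they are multiplied with complex Hadamard matrices.\<close>

definition adjacency_matrix :: "nat \<Rightarrow> nat set set \<Rightarrow> (nat set \<Rightarrow> real) \<Rightarrow> complex mat" where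
  "adjacency_matrix n E w =
     mat n n (\<lambda>(i, j). if {i, j} \<in> E then complex_of_real (w {i, j}) else 0)"

definition degree_matrix :: "nat \<Rightarrow> nat set set \<Rightarrow> (nat set \<Rightarrow> real) \<Rightarrow> complex mat" where
  "degree_matrix n E w =
     mat n n (\<lambda>(i, j). if i = j then (\<Sum>k<n. adjacency_matrix n E w $$ (i, k)) else 0)"

definition laplacian_matrix :: "nat \<Rightarrow> nat set set \<Rightarrow> (nat set \<Rightarrow> real) \<Rightarrow> complex mat" where
  "laplacian_matrix n E w = degree_matrix n E w - adjacency_matrix n E w"

definition butson_hadamard :: "nat \<Rightarrow> nat \<Rightarrow> complex mat set" where
  "butson_hadamard r n =
     {H \<in> carrier_mat n n. (\<forall>i<n. \<forall>j<n. (H $$ (i, j)) ^ r = 1)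
        \<and> H * mat_adjoint H = of_nat n \<cdot>\<^sub>m 1\<^sub>m n}"

definition diagonalisable_by :: "complex mat \<Rightarrow> complex mat \<Rightarrow> bool" where
  "diagonalisable_by A H \<longleftrightarrow> (\<forall>j<dim_col H. \<exists>c. eigenvector A (col H j) c)"

end

theory Submission
  imports Defs
begin

text \<open>Every eigenvalue of \<open>L\<close> belongs to some column \<open>h\<close> of \<open>H\<close>. Dividing row \<open>i\<close> of
  \<open>L h = k h\<close> by \<open>h\<^sub>i\<close> writes \<open>k\<close> as a sum of terms \<open>a\<^sub>l (1 - z\<^sub>l)\<close> with \<open>a\<^sub>l\<close> an integer and
  \<open>z\<^sub>l\<close> a root of unity of order dividing \<open>2 ^ m\<close>. Modulo the prime above 2 every \<open>z\<^sub>l\<close> is 1,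
  so \<open>k\<close> vanishes there and is even.\<close>

text \<open>Induction on coefficients: prepending a coefficient multiplies by \<open>x\<close>,
  which turns the even part into the odd one and the odd part, shifted by \<open>x * x\<close>, into
  the even one.\<close>

lemma poly_even_odd_split:
  fixes p :: "'a :: comm_ring_1 poly"
  shows "\<exists>a b. p = a \<circ>\<^sub>p [:0, 0, 1:] + [:0, 1:] * (b \<circ>\<^sub>p [:0, 0, 1:])"
proof (induction p)
  case 0
  show ?case by (intro exI[of _ 0]) simp
next
  case (pCons c p)
  then obtain a b where "p = a \<circ>\<^sub>p [:0, 0, 1:] + [:0, 1:] * (b \<circ>\<^sub>p [:0, 0, 1:])"
    by blast
  then have "pCons c p = pCons c b \<circ>\<^sub>p [:0, 0, 1:] + [:0, 1:] * (a \<circ>\<^sub>p [:0, 0, 1:])"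
    by (simp add: pcompose_pCons)
  then show ?case by blast
qed

text \<open>The product of \<open>p(x)\<close> and \<open>p(-x)\<close> is a polynomial in \<open>x\<^sup>2\<close> that vanishes at \<open>z\<^sup>2\<close>, and
  its value at 1 has the parity of \<open>p(1)\<close>.\<close>
lemma even_poly_1_if_root_of_unity_root:
  fixes p :: "int poly" and z :: "'a :: {comm_ring_1, ring_char_0}"
  assumes "z ^ (2 ^ m) = 1" and "poly (of_int_poly p) z = 0"
  shows "even (poly p 1)"
  using assms
proof (induction m arbitrary: p z)
  case 0
  then have "of_int (poly p 1) = (0 :: 'a)"
    by simp
  then show ?case by simp
next
  case (Suc m)
  obtain a b where p: "p = a \<circ>\<^sub>p [:0, 0, 1:] + [:0, 1:] * (b \<circ>\<^sub>p [:0, 0, 1:])"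
    using poly_even_odd_split by blast
  let ?A = "poly (of_int_poly a) (z\<^sup>2)" and ?B = "poly (of_int_poly b) (z\<^sup>2)"
  let ?q = "a * a - [:0, 1:] * (b * b)"
  have "poly (of_int_poly p) z = ?A + z * ?B"
    by (simp add: p of_int_poly_hom.map_poly_pcompose hom_distribs poly_pcompose power2_eq_square)
  then have "?A = - (z * ?B)"
    using Suc.prems(2) by (simp add: eq_neg_iff_add_eq_0)
  then have "poly (of_int_poly ?q) (z\<^sup>2) = 0"
    by (simp add: hom_distribs power2_eq_square algebra_simps)
  moreover have "(z\<^sup>2) ^ (2 ^ m) = 1"
    using Suc.prems(1) by (simp add: power_mult)
  ultimately have "even (poly ?q 1)"
    using Suc.IH by blast
  \<comment> \<open>At 1 the values are \<open>p = a + b\<close> and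
    \<open>?q = a * a - b * b = (a + b) * (a - b)\<close>, and the two factors differ by an even
    number.\<close>
  then show ?case
    by (simp add: p poly_pcompose)
qed

text \<open>All \<open>z l\<close> are powers of one root of unity \<omega>, so the relation for
  \<open>k\<close> becomes an integer polynomial equation satisfied by \<omega>, to which the parity
  lemma applies.\<close>

lemma even_if_sum_one_minus_roots_of_unity:
  fixes a :: "'b \<Rightarrow> int" and z :: "'b \<Rightarrow> complex"
  assumes roots: "\<And>l. l \<in> I \<Longrightarrow> z l ^ (2 ^ m) = 1"
    and k: "of_int k = (\<Sum>l\<in>I. of_int (a l) * (1 - z l))"
  shows "even k"
proof -
  define \<omega> where "\<omega> = cis (2 * pi / 2 ^ m)"
  have "\<exists>e. z l = \<omega> ^ e" if "l \<in> I" for l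
  proof -
    have "z l \<in> (\<lambda>e. cis (2 * pi * real e / real (2 ^ m))) ` {..<2 ^ m}"
      using bij_betw_roots_unity[of "2 ^ m"] roots[OF that]
      by (simp add: bij_betw_def)
    then show ?thesis
      by (auto simp: \<omega>_def DeMoivre mult_ac)
  qed
  then obtain e where e: "\<And>l. l \<in> I \<Longrightarrow> z l = \<omega> ^ e l"
    by metis
  \<comment> \<open>Chosen to vanish at \<omega>; at 1 each \<open>1 - x ^ e l\<close> vanishes,
    leaving \<open>- k\<close>.\<close>
  define p where "p = (\<Sum>l\<in>I. smult (a l) (1 - monom 1 (e l))) - [:k:]"
  have "of_int_poly p = (\<Sum>l\<in>I. smult (of_int (a l)) (1 - monom 1 (e l))) - [:of_int k :: complex:]"
    by (simp add: p_def hom_distribs)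
  then have "poly (of_int_poly p) \<omega> = 0"
    by (simp add: poly_sum poly_monom k e)
  moreover have "\<omega> ^ (2 ^ m) = 1"
    by (simp add: \<omega>_def DeMoivre)
  ultimately have "even (poly p 1)"
    by (rule even_poly_1_if_root_of_unity_root[rotated])
  then show ?thesis
    by (simp add: p_def poly_sum poly_monom)
qed

text \<open>With the column eigenvalues on the diagonal of \<open>D\<close>, the columns give
  \<open>A * H = H * D\<close>. As \<open>H\<close> is invertible, \<open>A\<close> is similar to
  \<open>D\<close>, and the roots of their common characteristic polynomial are the diagonal entries
  of \<open>D\<close>.\<close>

lemma eigenvalue_of_some_column:
  fixes A H K :: "'a :: field mat"
  assumes A: "A \<in> carrier_mat n n" and H: "H \<in> carrier_mat n n" and K: "K \<in> carrier_mat n n"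
    and HK: "H * K = 1\<^sub>m n"
    and columns: "\<And>j. j < n \<Longrightarrow> \<exists>c. eigenvector A (col H j) c"
    and k: "eigenvalue A k"
  obtains j where "j < n" and "eigenvector A (col H j) k"
proof -
  obtain c where c: "\<And>j. j < n \<Longrightarrow> eigenvector A (col H j) (c j)"
    using columns by metis
  define D where "D = mat_diag n c"
  have D: "D \<in> carrier_mat n n"
    by (simp add: D_def)
  have "A * H = H * D"
  proof (rule eq_matI)
    fix i j assume "i < dim_row (H * D)" and "j < dim_col (H * D)"
    then have ij: "i < n" "j < n"
      using H D by auto
    have "(A * H) $$ (i, j) = (A *\<^sub>v col H j) $ i"
      using A H ij by simp
    also have "\<dots> = c j * H $$ (i, j)"
      using c[OF ij(2)] H ij by (simp add: eigenvector_def)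
    also have "\<dots> = (H * D) $$ (i, j)"
      using ij by (simp add: D_def mat_diag_mult_right[OF H])
    finally show "(A * H) $$ (i, j) = (H * D) $$ (i, j)" .
  qed (use A H D in auto)
  then have "A = H * D * K"
    using A H K HK by (metis assoc_mult_mat right_mult_one_mat)
  then have "similar_mat_wit A D H K"
    using A H K D HK mat_mult_left_right_inverse[OF H K HK] by (intro similar_mat_witI)
  then have "char_poly A = char_poly D"
    using char_poly_similar similar_mat_def by blast
  also have "\<dots> = (\<Prod>d \<leftarrow> diag_mat D. [:- d, 1:])"
    by (rule char_poly_upper_triangular[OF D]) (auto simp: D_def mat_diag_def)
  finally have "poly (\<Prod>d \<leftarrow> diag_mat D. [:- d, 1:]) k = 0"
    using k eigenvalue_root_char_poly[OF A] by simp
  then have "k \<in> set (diag_mat D)"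
    by (auto simp: poly_prod_list)
  then obtain j where "j < n" "k = c j"
    by (auto simp: diag_mat_def D_def mat_diag_def)
  then show thesis
    using c that by blast
qed

text \<open>The degree is a row sum, so each weight meets \<open>x $ i\<close> once. Written with
  differences, the formula yields terms \<open>1 - x $ l / x $ i\<close> after division by
  \<open>x $ i\<close>.\<close>

lemma laplacian_mult_vec_index:
  assumes "x \<in> carrier_vec n" and "i < n"
  shows "(laplacian_matrix n E w *\<^sub>v x) $ i =
    (\<Sum>l<n. adjacency_matrix n E w $$ (i, l) * (x $ i - x $ l))"
proof -
  let ?A = "adjacency_matrix n E w"
  have "(laplacian_matrix n E w *\<^sub>v x) $ i =
      (\<Sum>l<n. (if i = l then \<Sum>k<n. ?A $$ (i, k) else 0) * x $ l - ?A $$ (i, l) * x $ l)"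
    using assms
    by (simp add: laplacian_matrix_def degree_matrix_def adjacency_matrix_def scalar_prod_def
        lessThan_atLeast0 left_diff_distrib)
  also have "\<dots> = (\<Sum>k<n. ?A $$ (i, k)) * x $ i - (\<Sum>l<n. ?A $$ (i, l) * x $ l)"
    using assms by (simp add: sum_subtractf if_distrib[of "\<lambda>t. t * _"] cong: if_cong)
  finally show ?thesis
    by (simp add: right_diff_distrib sum_subtractf sum_distrib_right)
qed

theorem theorem3p2:
  fixes n m :: nat and E :: "nat set set" and w :: "nat set \<Rightarrow> real" and H :: "complex mat"
  assumes "weighted_graph n E w"
    and "integer_weighted E w"
    and "m > 0"
    and "H \<in> butson_hadamard (2 ^ m) n"
    and "diagonalisable_by (laplacian_matrix n E w) H"
  shows "\<forall>k :: int. eigenvalue (laplacian_matrix n E w) (complex_of_int k) \<longrightarrow> even k"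
proof (intro allI impI)
  fix k :: int
  let ?L = "laplacian_matrix n E w" and ?A = "adjacency_matrix n E w"
  assume k: "eigenvalue ?L (complex_of_int k)"
  have L: "?L \<in> carrier_mat n n"
    by (simp add: laplacian_matrix_def adjacency_matrix_def minus_carrier_mat)
  have H: "H \<in> carrier_mat n n"
    and unit: "\<And>i j. i < n \<Longrightarrow> j < n \<Longrightarrow> (H $$ (i, j)) ^ (2 ^ m) = 1"
    and HH: "H * mat_adjoint H = of_nat n \<cdot>\<^sub>m 1\<^sub>m n"
    using assms(4) by (auto simp: butson_hadamard_def)
  \<comment> \<open>An eigenvector is nonzero, so the dimension is positive; this permits division
    by \<open>n\<close> and the use of row 0.\<close>
  have "n > 0"
    using k L by (auto simp: eigenvalue_def eigenvector_def)
  let ?K = "(1 / of_nat n) \<cdot>\<^sub>m mat_adjoint H"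
  have adj: "mat_adjoint H \<in> carrier_mat n n"
    using H by (auto simp: mat_adjoint_def)
  have "H * ?K = 1\<^sub>m n"
    using H adj HH \<open>n > 0\<close> by (simp add: mult_smult_distrib) auto
  moreover have "\<And>j. j < n \<Longrightarrow> \<exists>c. eigenvector ?L (col H j) c"
    using assms(5) H by (auto simp: diagonalisable_by_def)
  ultimately obtain j where j: "j < n" and ev: "eigenvector ?L (col H j) (of_int k)"
    using eigenvalue_of_some_column[OF L H _ _ _ k, of ?K] adj by auto
  define h where "h l = H $$ (l, j)" for l
  have h: "h l ^ (2 ^ m) = 1" if "l < n" for l
    using unit that j by (simp add: h_def)
  have h0: "h 0 \<noteq> 0"
    using h[of 0] \<open>n > 0\<close> by (auto simp: power_0_left)
  have "\<exists>a. ?A $$ (0, l) = of_int a" if "l < n" for l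
  proof (cases "{0, l} \<in> E")
    case True
    then obtain a where "w {0, l} = of_int a"
      using assms(2) by (auto simp: integer_weighted_def elim: Ints_cases)
    then show ?thesis
      using True that by (auto simp: adjacency_matrix_def)
  next
    case False
    then show ?thesis
      using that by (auto simp: adjacency_matrix_def intro: exI[of _ 0])
  qed
  then obtain a where a: "\<And>l. l < n \<Longrightarrow> ?A $$ (0, l) = of_int (a l)"
    by metis
  \<comment> \<open>Row 0 is an arbitrary choice: every entry of the column is a root of unity,
    hence invertible.\<close>
  have "of_int k * h 0 = (?L *\<^sub>v col H j) $ 0"
    using ev H j \<open>n > 0\<close> by (simp add: eigenvector_def h_def)
  also have "\<dots> = (\<Sum>l<n. of_int (a l) * (h 0 - h l))"
    using H j \<open>n > 0\<close> by (subst laplacian_mult_vec_index) (auto simp: a h_def)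
  finally have "of_int k = (\<Sum>l<n. of_int (a l) * (h 0 - h l)) / h 0"
    using h0 by (simp add: field_simps)
  also have "\<dots> = (\<Sum>l<n. of_int (a l) * (1 - h l / h 0))"
    using h0 by (simp add: sum_divide_distrib diff_divide_distrib right_diff_distrib)
  finally show "even k"
    using h \<open>n > 0\<close>
    \<comment> \<open>Quotients of roots of unity of order dividing \<open>2 ^ m\<close> are again
      such roots.\<close>
    by (intro even_if_sum_one_minus_roots_of_unity
          [where I = "{..<n}" and z = "\<lambda>l. h l / h 0" and m = m])
      (simp_all add: power_divide h0)
qed

end
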